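(* For integers $k \geq 2$ and $n \geq 6$, $$ gr_{k}(K_{3} : W_{n}) \geq \begin{cases} (3n - 4) 5^{\frac{k - 2}{2}} + 1 & \text{ if $n$ is even and $k$ is even;}\\ (6n - 8) 5^{\frac{k - 3}{2}} + 1 & \text{ if $n$ is even and $k$ is odd;}\\ (2n - 3) 5^{\frac{k - 2}{2}} + 1 & \text{ if $n$ is odd and $k$ is even;}\\ (4n - 6) 5^{\frac{k - 3}{2}} + 1 & \text{ if $n$ is odd and $k$ is odd.} \end{cases} $$
   Context: For $n \geq 4$, the wheel $W_n$ is the graph of order $n$ given by $W_n = K_1 \vee C_{n-1}$, i.e., a cycle on $n-1$ vertices together with one additional vertex adjacent to all vertices of the cycle. For graphs $G$, $H$ and a positive integer $k$, the Gallai-Ramsey number $gr_k(G:H)$ is the minimum integer $m$ such that every coloring of the edges of $K_m$ using at most $k$ colors contains either a rainbow copy of $G$ (all edges receiving distinct colors) or a monochromatic copy of $H$. *)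

theory Defs
  imports Main "HOL-Library.Ramsey"
begin

type_synonym 'a ugraph = "'a set \<times> 'a set set"

abbreviation verts :: "'a ugraph \<Rightarrow> 'a set" where
  "verts G \<equiv> fst G"

abbreviation edges :: "'a ugraph \<Rightarrow> 'a set set" where
  "edges G \<equiv> snd G"

definition complete_graph :: "nat \<Rightarrow> nat ugraph" where
  "complete_graph n = ({..<n}, nsets {..<n} 2)"

text \<open>Only for \<open>n \<ge> 3\<close> is this the usual simple cycle.\<close>

definition cycle_graph :: "nat \<Rightarrow> nat ugraph" where
  "cycle_graph n = ({..<n}, (\<lambda>i. {i, (i + 1) mod n}) ` {..<n})"

definition graph_join :: "'a ugraph \<Rightarrow> 'b ugraph \<Rightarrow> ('a + 'b) ugraph" where
  "graph_join G H =
     (verts G <+> verts H,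
      (image Inl) ` edges G \<union> (image Inr) ` edges H \<union>
      {{Inl u, Inr v} |u v. u \<in> verts G \<and> v \<in> verts H})"

definition wheel :: "nat \<Rightarrow> (nat + nat) ugraph" where
  "wheel n = graph_join (complete_graph 1) (cycle_graph (n - 1))"

text \<open>A copy of \<open>G\<close> in \<open>H\<close> is a not necessarily induced subgraph of \<open>H\<close> isomorphic to \<open>G\<close>;
  it is represented by an embedding of \<open>G\<close> into \<open>H\<close>.\<close>

definition graph_embedding :: "('a \<Rightarrow> 'b) \<Rightarrow> 'a ugraph \<Rightarrow> 'b ugraph \<Rightarrow> bool" where
  "graph_embedding f G H \<longleftrightarrow>
     inj_on f (verts G) \<and> f ` verts G \<subseteq> verts H \<and> (\<forall>e \<in> edges G. f ` e \<in> edges H)"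

definition has_rainbow_copy :: "'b ugraph \<Rightarrow> ('b set \<Rightarrow> nat) \<Rightarrow> 'a ugraph \<Rightarrow> bool" where
  "has_rainbow_copy K c G \<longleftrightarrow>
     (\<exists>f. graph_embedding f G K \<and> inj_on (\<lambda>e. c (f ` e)) (edges G))"

definition has_monochromatic_copy :: "'b ugraph \<Rightarrow> ('b set \<Rightarrow> nat) \<Rightarrow> 'a ugraph \<Rightarrow> bool" where
  "has_monochromatic_copy K c H \<longleftrightarrow>
     (\<exists>f. graph_embedding f H K \<and> (\<exists>i. \<forall>e \<in> edges H. c (f ` e) = i))"

text \<open>The colors are \<open>0, \<dots>, k - 1\<close>, not all of which have to be used. The minimum is attained
  for finite \<open>H\<close> by Ramsey's theorem.\<close>

definition gallai_ramsey :: "nat \<Rightarrow> 'a ugraph \<Rightarrow> 'b ugraph \<Rightarrow> nat" where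
  "gallai_ramsey k G H =
     (LEAST m. \<forall>c \<in> edges (complete_graph m) \<rightarrow> {..<k}.
        has_rainbow_copy (complete_graph m) c G \<or>
        has_monochromatic_copy (complete_graph m) c H)"

end

theory Submission
  imports Defs
begin

text \<open>
  Substituting a Gallai coloring of \<open>K\<^sub>N\<close> into every vertex of a Gallai coloring of \<open>K\<^sub>M\<close> that uses
  fresh colors gives a Gallai coloring of \<open>K\<^sub>M\<^sub>N\<close>. A monochromatic wheel in an old color lies inside
  one block, and a monochromatic wheel in a fresh color projects to a homomorphic image of the
  wheel in the outer coloring. Start with a monochromatic \<open>K\<^sub>n\<^sub>-\<^sub>1\<close>, which is too small to contain
  \<open>W\<^sub>n\<close>. Suitable outer colorings are: a monochromatic \<open>K\<^sub>2\<close> (one fresh color), the 2-coloring of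
  \<open>K\<^sub>5\<close> by two pentagons (two fresh colors), both without monochromatic triangles, and, if \<open>n\<close> is
  even, a monochromatic \<open>K\<^sub>3\<close>, since then \<open>W\<^sub>n\<close> is not 3-colorable. This gives colorings of
  \<open>K\<^sub>m\<close> with \<open>m = 3(n-1) \<cdot> 5\<^sup>j\<close> for even \<open>n\<close> and \<open>m = 2(n-1) \<cdot> 5\<^sup>j\<close> for odd \<open>n\<close>, with a further factor
  2 if \<open>k\<close> is odd.
\<close>

text \<open>A function of two vertices, not of an edge set, so that \<open>div\<close> and
  \<open>mod\<close> can act on the arguments. Symmetry is required on all naturals, while diagonal
  values stay free.\<close>

definition gallai_coloring :: "nat set \<Rightarrow> nat \<Rightarrow> (nat \<Rightarrow> nat \<Rightarrow> nat) \<Rightarrow> bool" where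
  "gallai_coloring C N d \<longleftrightarrow>
     (\<forall>x y. d x y = d y x) \<and>
     (\<forall>x<N. \<forall>y<N. x \<noteq> y \<longrightarrow> d x y \<in> C) \<and>
     (\<forall>x<N. \<forall>y<N. \<forall>z<N. x \<noteq> y \<longrightarrow> y \<noteq> z \<longrightarrow> x \<noteq> z \<longrightarrow>
        d x y = d y z \<or> d x y = d x z \<or> d y z = d x z)"

text \<open>A homomorphic image, in color \<open>i\<close>, of the wheel with hub \<open>h\<close> and rim \<open>g 0, \<dots>, g (r - 1)\<close>;
  the rim vertices need not be distinct.\<close>

definition wheel_hom ::
    "nat \<Rightarrow> nat \<Rightarrow> (nat \<Rightarrow> nat \<Rightarrow> nat) \<Rightarrow> nat \<Rightarrow> nat \<Rightarrow> (nat \<Rightarrow> nat) \<Rightarrow> bool" where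
  "wheel_hom r N d i h g \<longleftrightarrow> h < N \<and>
     (\<forall>j<r. g j < N \<and> h \<noteq> g j \<and> g j \<noteq> g (Suc j mod r) \<and>
        d h (g j) = i \<and> d (g j) (g (Suc j mod r)) = i)"

definition wheel_free :: "nat \<Rightarrow> nat \<Rightarrow> (nat \<Rightarrow> nat \<Rightarrow> nat) \<Rightarrow> bool" where
  "wheel_free r N d \<longleftrightarrow> (\<forall>i h g. wheel_hom r N d i h g \<longrightarrow> \<not> inj_on g {..<r})"

section \<open>Substitution of one coloring into another\<close>

text \<open>The number \<open>x\<close> encodes the pair of its block \<open>x mod M\<close>, a
  vertex of the outer coloring \<open>e\<close>, and its position \<open>x div M\<close> inside that
  block, colored by \<open>d\<close>.\<close>

definition substitute ::
    "nat \<Rightarrow> (nat \<Rightarrow> nat \<Rightarrow> nat) \<Rightarrow> (nat \<Rightarrow> nat \<Rightarrow> nat) \<Rightarrow> nat \<Rightarrow> nat \<Rightarrow> nat" where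
  "substitute M e d x y =
     (if x mod M = y mod M then d (x div M) (y div M) else e (x mod M) (y mod M))"

lemma eq_if_div_mod_eq: "x = y" if "x mod M = y mod M" "x div M = y div M" for x y M :: nat
  using that by (metis div_mult_mod_eq)

text \<open>A triangle inside one block is handled by \<open>d\<close>, one that meets three blocks
  by \<open>e\<close>. If exactly two vertices share a block, the third one sees both in the same
  color.\<close>

lemma gallai_coloring_substitute:
  assumes d: "gallai_coloring C N d" and e: "gallai_coloring D M e"
  shows "gallai_coloring (C \<union> D) (M * N) (substitute M e d)"
proof -
  have pos: "M > 0" "x div M < N" "x mod M < M" if "x < M * N" for x
    using that by (auto simp: less_mult_imp_div_less mult.commute intro!: mod_less_divisor gr0I)
  have sd: "d x y = d y x" and se: "e x y = e y x" for x y
    using d e by (auto simp: gallai_coloring_def)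
  have rd: "x < N \<Longrightarrow> y < N \<Longrightarrow> x \<noteq> y \<Longrightarrow> d x y \<in> C" for x y
    using d by (auto simp: gallai_coloring_def)
  have re: "x < M \<Longrightarrow> y < M \<Longrightarrow> x \<noteq> y \<Longrightarrow> e x y \<in> D" for x y
    using e by (auto simp: gallai_coloring_def)
  have td: "d x y = d y z \<or> d x y = d x z \<or> d y z = d x z"
    if "x < N" "y < N" "z < N" "x \<noteq> y" "y \<noteq> z" "x \<noteq> z" for x y z
    using d that by (auto simp: gallai_coloring_def)
  have te: "e x y = e y z \<or> e x y = e x z \<or> e y z = e x z"
    if "x < M" "y < M" "z < M" "x \<noteq> y" "y \<noteq> z" "x \<noteq> z" for x y z
    using e that by (auto simp: gallai_coloring_def)
  let ?s = "substitute M e d"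
  show ?thesis
    unfolding gallai_coloring_def
  proof (intro conjI allI impI)
    show "?s x y = ?s y x" for x y
      using sd se by (auto simp: substitute_def)
    show "?s x y \<in> C \<union> D" if "x < M * N" "y < M * N" "x \<noteq> y" for x y
      using that pos[of x] pos[of y] rd re eq_if_div_mod_eq[of x M y]
      by (auto simp: substitute_def)
    show "?s x y = ?s y z \<or> ?s x y = ?s x z \<or> ?s y z = ?s x z"
      if less: "x < M * N" "y < M * N" "z < M * N" and ne: "x \<noteq> y" "y \<noteq> z" "x \<noteq> z" for x y z
    proof (cases "x mod M = y mod M \<or> y mod M = z mod M \<or> x mod M = z mod M")
      case True
      show ?thesis
      proof (cases "x mod M = y mod M \<and> y mod M = z mod M")
        case True
        then have "x div M \<noteq> y div M" "y div M \<noteq> z div M" "x div M \<noteq> z div M"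
          using ne eq_if_div_mod_eq by metis+
        then show ?thesis
          using True td[of "x div M" "y div M" "z div M"] pos less by (simp add: substitute_def)
      next
        case False
        then show ?thesis
          using True se by (auto simp: substitute_def)
      qed
    next
      case False
      then show ?thesis
        using te[of "x mod M" "y mod M" "z mod M"] pos less by (simp add: substitute_def)
    qed
  qed
qed

lemma wheel_free_substitute:
  assumes d: "gallai_coloring C N d" and free: "wheel_free r N d"
    and e: "gallai_coloring D M e" and no_hom: "\<And>i h g. \<not> wheel_hom r M e i h g"
    and disj: "C \<inter> D = {}" and r: "r > 0"
  shows "wheel_free r (M * N) (substitute M e d)"
  unfolding wheel_free_def
proof (intro allI impI notI)
  fix i h g
  assume hom: "wheel_hom r (M * N) (substitute M e d) i h g" and inj: "inj_on g {..<r}"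
  let ?s = "substitute M e d"
  have pos: "x div M < N" "x mod M < M" if "x < M * N" for x
    using that by (auto simp: less_mult_imp_div_less mult.commute intro!: mod_less_divisor gr0I)
  have rd: "x < N \<Longrightarrow> y < N \<Longrightarrow> x \<noteq> y \<Longrightarrow> d x y \<in> C" for x y
    using d by (auto simp: gallai_coloring_def)
  have re: "x < M \<Longrightarrow> y < M \<Longrightarrow> x \<noteq> y \<Longrightarrow> e x y \<in> D" for x y
    using e by (auto simp: gallai_coloring_def)
  \<comment> \<open>As the palettes are disjoint, the color of an edge reveals whether its ends
    share a block.\<close>
  have same: "?s x y \<in> C \<longleftrightarrow> x mod M = y mod M" if "x < M * N" "y < M * N" "x \<noteq> y" for x y
    using that pos[of x] pos[of y] rd[of "x div M" "y div M"] re[of "x mod M" "y mod M"] disj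
      eq_if_div_mod_eq[of x M y]
    by (auto simp: substitute_def)
  have h: "h < M * N"
    using hom by (simp add: wheel_hom_def)
  have rim: "g j < M * N" "h \<noteq> g j" "g j \<noteq> g (Suc j mod r)" "?s h (g j) = i"
    "?s (g j) (g (Suc j mod r)) = i" "g (Suc j mod r) < M * N" if "j < r" for j
    using hom that r by (auto simp: wheel_hom_def)
  show False
  proof (cases "i \<in> C")
    case True
    \<comment> \<open>The hub is joined to every rim vertex in an old color, which pulls the whole
      wheel into its block. There the \<open>mod\<close> parts agree, so the \<open>div\<close>
      parts stay distinct.\<close>
    have block: "g j mod M = h mod M" if "j < r" for j
      using same[of h "g j"] rim[OF that] h True by simp
    have "wheel_hom r N d i (h div M) (\<lambda>j. g j div M)"
      unfolding wheel_hom_def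
    proof (intro conjI allI impI)
      fix j assume j: "j < r"
      have j': "Suc j mod r < r"
        using r by simp
      show "h div M \<noteq> g j div M" "g j div M \<noteq> g (Suc j mod r) div M"
        using rim[OF j] block[OF j] block[OF j'] eq_if_div_mod_eq by metis+
      show "d (h div M) (g j div M) = i" "d (g j div M) (g (Suc j mod r) div M) = i"
        using rim(4,5)[OF j] block[OF j] block[OF j'] by (simp_all add: substitute_def)
    qed (use pos h rim in auto)
    moreover have "inj_on (\<lambda>j. g j div M) {..<r}"
      using inj block eq_if_div_mod_eq unfolding inj_on_def by (metis lessThan_iff)
    ultimately show False
      using free by (auto simp: wheel_free_def)
  next
    case False
    have "wheel_hom r M e i (h mod M) (\<lambda>j. g j mod M)"
      unfolding wheel_hom_def
    proof (intro conjI allI impI)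
      fix j assume j: "j < r"
      show ne: "h mod M \<noteq> g j mod M" "g j mod M \<noteq> g (Suc j mod r) mod M"
        using same[of h "g j"] same[of "g j" "g (Suc j mod r)"] rim[OF j] h False by auto
      show "e (h mod M) (g j mod M) = i" "e (g j mod M) (g (Suc j mod r) mod M) = i"
        using rim(4,5)[OF j] ne by (simp_all add: substitute_def)
    qed (use pos h rim in auto)
    then show False
      using no_hom by blast
  qed
qed

section \<open>Outer colorings and the initial clique\<close>

text \<open>The hub and the rim vertices \<open>g 0\<close> and \<open>g 1\<close> form a
  monochromatic triangle.\<close>

lemma not_wheel_hom_if_no_mono_triangle:
  assumes "\<And>x y z. x < M \<Longrightarrow> y < M \<Longrightarrow> z < M \<Longrightarrow> x \<noteq> y \<Longrightarrow> y \<noteq> z \<Longrightarrow> x \<noteq> z \<Longrightarrow>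
      e x y = e y z \<Longrightarrow> e x y = e x z \<Longrightarrow> False"
    and "r \<ge> 2"
  shows "\<not> wheel_hom r M e i h g"
proof
  assume hom: "wheel_hom r M e i h g"
  have rim: "g j < M" "h \<noteq> g j" "g j \<noteq> g (Suc j mod r)" "e h (g j) = i"
    "e (g j) (g (Suc j mod r)) = i" if "j < r" for j
    using hom that by (auto simp: wheel_hom_def)
  have "h < M"
    using hom by (simp add: wheel_hom_def)
  then show False
    using rim[of 0] rim[of 1] assms(1)[of h "g 0" "g 1"] \<open>r \<ge> 2\<close> by simp
qed

text \<open>The hub occupies one of the three vertices, so the rim would be a closed walk of odd
  length alternating between the other two.\<close>

lemma not_wheel_hom_3_if_odd:
  assumes "odd r"
  shows "\<not> wheel_hom r 3 e i h g"
proof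
  assume hom: "wheel_hom r 3 e i h g"
  have rim: "g j < 3" "h \<noteq> g j" "g j \<noteq> g (Suc j mod r)" if "j < r" for j
    using hom that by (auto simp: wheel_hom_def)
  have h: "h < 3"
    using hom by (simp add: wheel_hom_def)
  have r: "r > 0"
    using assms by (auto intro: gr0I)
  have alternating: "j < r \<Longrightarrow> g j = g 0 \<longleftrightarrow> even j" for j
  proof (induction j)
    case (Suc j)
    have "g j \<noteq> g (Suc j)"
      using rim(3)[of j] Suc.prems by simp
    then show ?case
      using Suc rim(1,2)[of 0] rim(1,2)[of j] rim(1,2)[of "Suc j"] h by auto
  qed simp
  \<comment> \<open>Since \<open>r - 1\<close> is even, alternation returns to \<open>g 0\<close>,
    but the closing rim edge separates \<open>g (r - 1)\<close> from \<open>g 0\<close>.\<close>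
  have "g (r - 1) = g 0"
    using alternating[of "r - 1"] assms r by simp
  moreover have "g (r - 1) \<noteq> g 0"
    using rim(3)[of "r - 1"] r by simp
  ultimately show False
    by simp
qed

lemma wheel_free_complete: "wheel_free r r d"
  unfolding wheel_free_def
proof (intro allI impI notI)
  fix i h g
  assume hom: "wheel_hom r r d i h g" and inj: "inj_on g {..<r}"
  have "insert h (g ` {..<r}) \<subseteq> {..<r}"
    using hom by (auto simp: wheel_hom_def)
  then have "card (insert h (g ` {..<r})) \<le> r"
    using card_mono[of "{..<r}" "insert h (g ` {..<r})"] by simp
  moreover have "h \<notin> g ` {..<r}"
    using hom by (auto simp: wheel_hom_def)
  ultimately show False
    using inj by (simp add: card_image)
qed

lemma gallai_coloring_const: "gallai_coloring {c} N (\<lambda>_ _. c)"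
  by (simp add: gallai_coloring_def)

text \<open>On vertices below 5, differences of 1 modulo 5 (up to sign) get color \<open>k\<close>
  and differences of 2 get \<open>Suc k\<close>; each class is a 5-cycle.\<close>

definition pentagon_coloring :: "nat \<Rightarrow> nat \<Rightarrow> nat \<Rightarrow> nat" where
  "pentagon_coloring k x y =
     (if Suc x mod 5 = y mod 5 \<or> Suc y mod 5 = x mod 5 then k else Suc k)"

lemma gallai_coloring_pentagon: "gallai_coloring {k, Suc k} 5 (pentagon_coloring k)"
  by (auto simp: gallai_coloring_def pentagon_coloring_def)

lemma no_mono_triangle_pentagon:
  assumes "x < 5" "y < 5" "z < 5" "x \<noteq> y" "y \<noteq> z" "x \<noteq> z"
    "pentagon_coloring k x y = pentagon_coloring k y z"
    "pentagon_coloring k x y = pentagon_coloring k x z"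
  shows False
proof -
  have "x \<in> {0,1,2,3,4}" "y \<in> {0,1,2,3,4}" "z \<in> {0,1,2,3,4}"
    using assms by auto
  then show False
    using assms(4-) by (auto simp: pentagon_coloring_def)
qed

section \<open>Growing the coloring color by color\<close>

definition avoidable :: "nat \<Rightarrow> nat \<Rightarrow> nat \<Rightarrow> bool" where
  "avoidable r k N \<longleftrightarrow> (\<exists>d. gallai_coloring {..<k} N d \<and> wheel_free r N d)"

lemma avoidable_1: "avoidable r 1 r"
  using gallai_coloring_const[of 0 r] wheel_free_complete
  by (auto simp: avoidable_def lessThan_Suc)

lemma avoidable_substitute:
  assumes "avoidable r k N" and "gallai_coloring {k..<l} M e" and "\<And>i h g. \<not> wheel_hom r M e i h g"
    and "r > 0" and "k \<le> l"
  shows "avoidable r l (M * N)"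
proof -
  obtain d where d: "gallai_coloring {..<k} N d" "wheel_free r N d"
    using assms(1) by (auto simp: avoidable_def)
  have "{..<k} \<inter> {k..<l} = {}" and un: "{..<k} \<union> {k..<l} = {..<l}"
    using \<open>k \<le> l\<close> by auto
  with wheel_free_substitute[OF d assms(2,3)] gallai_coloring_substitute[OF d(1) assms(2)] \<open>r > 0\<close>
  show ?thesis
    by (auto simp: avoidable_def)
qed

lemma avoidable_double:
  assumes "avoidable r k N" and "r \<ge> 2"
  shows "avoidable r (Suc k) (2 * N)"
proof (rule avoidable_substitute[OF assms(1)])
  show "gallai_coloring {k..<Suc k} 2 (\<lambda>_ _. k)"
    using gallai_coloring_const[of k 2] by simp
  show "\<not> wheel_hom r 2 (\<lambda>_ _. k) i h g" for i h g
    by (rule not_wheel_hom_if_no_mono_triangle) (use assms in auto)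
qed (use assms in auto)

lemma avoidable_triple:
  assumes "avoidable r k N" and "odd r"
  shows "avoidable r (Suc k) (3 * N)"
proof (rule avoidable_substitute[OF assms(1)])
  show "gallai_coloring {k..<Suc k} 3 (\<lambda>_ _. k)"
    using gallai_coloring_const[of k 3] by simp
  show "\<not> wheel_hom r 3 (\<lambda>_ _. k) i h g" for i h g
    using not_wheel_hom_3_if_odd assms by blast
qed (use assms in \<open>auto intro: gr0I\<close>)

lemma avoidable_quintuple:
  assumes "avoidable r k N" and "r \<ge> 2"
  shows "avoidable r (k + 2) (5 * N)"
proof (rule avoidable_substitute[OF assms(1)])
  have "{k..<k + 2} = {k, Suc k}"
    by auto
  then show "gallai_coloring {k..<k + 2} 5 (pentagon_coloring k)"
    using gallai_coloring_pentagon by simp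
  show "\<not> wheel_hom r 5 (pentagon_coloring k) i h g" for i h g
    by (rule not_wheel_hom_if_no_mono_triangle) (use assms no_mono_triangle_pentagon in blast)+
qed (use assms in auto)

lemma avoidable_power:
  assumes "avoidable r k N" and "r \<ge> 2"
  shows "avoidable r (k + 2 * j) (N * 5 ^ j)"
proof (induction j)
  case (Suc j)
  then show ?case
    using avoidable_quintuple[OF Suc assms(2)] by (simp add: algebra_simps)
qed (use assms in simp)

section \<open>Transfer to graph copies and the Gallai-Ramsey number\<close>

lemma gallai_coloring_imp_no_rainbow_triangle:
  assumes d: "gallai_coloring C N d" and "m \<le> N"
    and c: "\<And>x y. x \<noteq> y \<Longrightarrow> c {x, y} = d x y"
  shows "\<not> has_rainbow_copy (complete_graph m) c (complete_graph 3)"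
proof
  assume "has_rainbow_copy (complete_graph m) c (complete_graph 3)"
  then obtain f where f: "graph_embedding f (complete_graph 3) (complete_graph m)"
    and inj: "inj_on (\<lambda>e. c (f ` e)) (nsets {..<3::nat} 2)"
    by (auto simp: has_rainbow_copy_def complete_graph_def)
  have "f x < N" if "x < 3" for x
    using f that \<open>m \<le> N\<close> by (force simp: graph_embedding_def complete_graph_def)
  moreover have "f x \<noteq> f y" if "x < 3" "y < 3" "x \<noteq> y" for x y
    using f that by (auto simp: graph_embedding_def complete_graph_def dest: inj_onD)
  ultimately have f3: "f 0 < N" "f 1 < N" "f 2 < N" "f 0 \<noteq> f 1" "f 1 \<noteq> f 2" "f 0 \<noteq> f 2"
    by auto
  then have "d (f 0) (f 1) = d (f 1) (f 2) \<or> d (f 0) (f 1) = d (f 0) (f 2)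
      \<or> d (f 1) (f 2) = d (f 0) (f 2)"
    using d by (auto simp: gallai_coloring_def)
  moreover have "d (f x) (f y) \<noteq> d (f u) (f v)"
    if "x < 3" "y < 3" "u < 3" "v < 3" "x \<noteq> y" "u \<noteq> v" "f x \<noteq> f y" "f u \<noteq> f v" "{x, y} \<noteq> {u, v}"
    for x y u v
    using inj_onD[OF inj, of "{x, y}" "{u, v}"] that c by auto
  ultimately show False
    using f3 by (auto simp: doubleton_eq_iff)
qed

lemma edges_wheel:
  "edges (wheel n) = (\<lambda>j. {Inr j, Inr (Suc j mod (n - 1))}) ` {..<n - 1}
     \<union> (\<lambda>j. {Inl 0, Inr j}) ` {..<n - 1}"
proof -
  have "nsets {..<Suc 0} 2 = {}"
    by (simp add: nsets_eq_empty)
  then show ?thesis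
    by (auto simp: wheel_def graph_join_def complete_graph_def cycle_graph_def image_image)
qed

lemma verts_wheel: "verts (wheel n) = insert (Inl 0) (Inr ` {..<n - 1})"
  by (auto simp: wheel_def graph_join_def complete_graph_def cycle_graph_def)

lemma wheel_free_imp_no_mono_wheel:
  assumes free: "wheel_free (n - 1) N d" and "m \<le> N" and "n \<ge> 3"
    and c: "\<And>x y. x \<noteq> y \<Longrightarrow> c {x, y} = d x y"
  shows "\<not> has_monochromatic_copy (complete_graph m) c (wheel n)"
proof
  assume "has_monochromatic_copy (complete_graph m) c (wheel n)"
  then obtain f i where f: "graph_embedding f (wheel n) (complete_graph m)"
    and mono: "\<And>e. e \<in> edges (wheel n) \<Longrightarrow> c (f ` e) = i"
    by (auto simp: has_monochromatic_copy_def)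
  have less: "f x < N" if "x \<in> verts (wheel n)" for x
    using f that \<open>m \<le> N\<close> by (force simp: graph_embedding_def complete_graph_def)
  have edge: "f x \<noteq> f y \<and> d (f x) (f y) = i" if "{x, y} \<in> edges (wheel n)" for x y
  proof -
    have "f ` {x, y} \<in> edges (complete_graph m)"
      using f that unfolding graph_embedding_def by blast
    then have "f x \<noteq> f y"
      by (simp add: complete_graph_def)
    then show ?thesis
      using mono[OF that] c by simp
  qed
  have spoke: "{Inl 0, Inr j} \<in> edges (wheel n)"
    and rim: "{Inr j, Inr (Suc j mod (n - 1))} \<in> edges (wheel n)" if "j < n - 1" for j
    using that by (auto simp: edges_wheel)
  have "wheel_hom (n - 1) N d i (f (Inl 0)) (\<lambda>j. f (Inr j))"
    unfolding wheel_hom_def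
    using less edge[OF spoke] edge[OF rim] by (auto simp: verts_wheel)
  moreover have "inj_on (\<lambda>j. f (Inr j)) {..<n - 1}"
    using f by (auto simp: graph_embedding_def verts_wheel inj_on_def)
  ultimately show False
    using free by (auto simp: wheel_free_def)
qed

lemma mono_clique_imp_mono_wheel:
  assumes H: "H \<in> nsets {..<m} n" and mono: "c ` nsets H 2 \<subseteq> {i}" and n: "n \<ge> 3"
  shows "has_monochromatic_copy (complete_graph m) c (wheel n)"
proof -
  have fin: "finite H" "card H = n" "H \<subseteq> {..<m}"
    using H by (auto simp: nsets_def)
  have "card (verts (wheel n)) = Suc (n - 1)" "finite (verts (wheel n))"
    by (auto simp: verts_wheel card_image card_insert_if)
  then obtain f where f: "bij_betw f (verts (wheel n)) H"
    using fin n finite_same_card_bij[of "verts (wheel n)" H] by auto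
  have inH: "f ` e \<in> nsets H 2" if "e \<in> edges (wheel n)" for e
  proof -
    \<comment> \<open>Rules out loops on the rim, so that every wheel edge is a genuine pair and
      lands inside the clique.\<close>
    have "Suc j mod (n - 1) \<noteq> j" if "j < n - 1" for j
      using that n by (cases "Suc j = n - 1") auto
    then have "e \<in> nsets (verts (wheel n)) 2"
      using that n by (auto simp: edges_wheel verts_wheel) metis
    then show ?thesis
      using f bij_betw_nsets[OF f, of 2] by (auto simp: bij_betw_def)
  qed
  have "graph_embedding f (wheel n) (complete_graph m)"
    unfolding graph_embedding_def
  proof (intro conjI ballI)
    show "inj_on f (verts (wheel n))" "f ` verts (wheel n) \<subseteq> verts (complete_graph m)"
      using f fin by (auto simp: bij_betw_def complete_graph_def)
    show "f ` e \<in> edges (complete_graph m)" if "e \<in> edges (wheel n)" for e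
      using inH[OF that] nsets_mono[OF fin(3), of 2] by (auto simp: complete_graph_def)
  qed
  moreover have "c (f ` e) = i" if "e \<in> edges (wheel n)" for e
    using inH[OF that] mono by auto
  ultimately show ?thesis
    by (auto simp: has_monochromatic_copy_def)
qed

text \<open>Supplies the witness without which the \<open>LEAST\<close> in
  \<open>gallai_ramsey\<close> could not be unfolded: a monochromatic clique on \<open>n\<close>
  vertices contains the wheel.\<close>

lemma ramsey_wheel:
  assumes "n \<ge> 3"
  shows "\<exists>m. \<forall>c \<in> edges (complete_graph m) \<rightarrow> {..<k}.
    has_monochromatic_copy (complete_graph m) c (wheel n)"
proof -
  obtain m :: nat where m: "partn_lst {..<m} (replicate k n) 2"
    using ramsey_full by blast
  have "has_monochromatic_copy (complete_graph m) c (wheel n)"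
    if "c \<in> edges (complete_graph m) \<rightarrow> {..<k}" for c
  proof -
    have "c \<in> nsets {..<m} 2 \<rightarrow> {..<length (replicate k n)}"
      using that by (simp add: complete_graph_def)
    then obtain i where "i < k" "monochromatic {..<m} (replicate k n ! i) 2 c i"
      using m unfolding partn_lst_def by auto
    then show ?thesis
      using mono_clique_imp_mono_wheel assms by (auto simp: monochromatic_def)
  qed
  then show ?thesis
    by blast
qed

text \<open>The coloring restricts to every \<open>m \<le> N\<close>, so the defining property fails
  at all these \<open>m\<close> and no monotonicity argument is required.\<close>

lemma gallai_ramsey_wheel_gt:
  assumes "avoidable (n - 1) k N" and n: "n \<ge> 3"
  shows "gallai_ramsey k (complete_graph 3) (wheel n) > N"
proof -
  obtain d where d: "gallai_coloring {..<k} N d" and free: "wheel_free (n - 1) N d"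
    using assms(1) by (auto simp: avoidable_def)
  \<comment> \<open>\<open>Min\<close> and \<open>Max\<close> recover the two ends of an edge;
    symmetry of \<open>d\<close> makes their order irrelevant.\<close>
  define c where "c e = d (Min e) (Max e)" for e
  have c: "c {x, y} = d x y" if "x \<noteq> y" for x y
    using d by (auto simp: c_def gallai_coloring_def min_def max_def)
  let ?P = "\<lambda>m. \<forall>c \<in> edges (complete_graph m) \<rightarrow> {..<k}.
    has_rainbow_copy (complete_graph m) c (complete_graph 3) \<or>
    has_monochromatic_copy (complete_graph m) c (wheel n)"
  have "\<exists>m. ?P m"
    using ramsey_wheel[OF n, of k] by blast
  then have "?P (gallai_ramsey k (complete_graph 3) (wheel n))"
    unfolding gallai_ramsey_def by (rule LeastI_ex)
  moreover have "\<not> ?P m" if "m \<le> N" for m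
  proof -
    have "d x y < k" if "x < m" "y < m" "x \<noteq> y" for x y
      using d that \<open>m \<le> N\<close> by (auto simp: gallai_coloring_def)
    then have "c \<in> edges (complete_graph m) \<rightarrow> {..<k}"
      by (auto simp: complete_graph_def c elim!: nsets2_E)
    then show ?thesis
      using gallai_coloring_imp_no_rainbow_triangle[OF d that c]
        wheel_free_imp_no_mono_wheel[OF free that n c] by blast
  qed
  ultimately show ?thesis
    by (meson not_le)
qed

theorem theorem8:
  fixes k n :: nat
  assumes "k \<ge> 2" and "n \<ge> 6"
  shows "gallai_ramsey k (complete_graph 3) (wheel n) \<ge>
    (if even n \<and> even k then (3 * n - 4) * 5 ^ ((k - 2) div 2) + 1
     else if even n \<and> odd k then (6 * n - 8) * 5 ^ ((k - 3) div 2) + 1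
     else if odd n \<and> even k then (2 * n - 3) * 5 ^ ((k - 2) div 2) + 1
     else (4 * n - 6) * 5 ^ ((k - 3) div 2) + 1)"
proof -
  let ?r = "n - 1" and ?G = "gallai_ramsey k (complete_graph 3) (wheel n)"
  define B where "B = (if even n then 3 * ?r else 2 * ?r)"
  have r: "?r \<ge> 2"
    using assms by simp
  have "avoidable ?r 2 B"
  proof (cases "even n")
    case True
    then have "odd ?r"
      using assms by simp
    then show ?thesis
      using True avoidable_triple[OF avoidable_1, of ?r] by (simp add: B_def numeral_2_eq_2)
  next
    case False
    then show ?thesis
      using avoidable_double[OF avoidable_1 r] by (simp add: B_def eval_nat_numeral)
  qed
  \<comment> \<open>Pentagons add colors in pairs: from two colors they reach every even
    \<open>k\<close>, and after one doubling every odd \<open>k \<ge> 3\<close>.\<close>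
  note even_bound = avoidable_power[OF this r]
    and odd_bound = avoidable_power[OF avoidable_double[OF this r] r]
  \<comment> \<open>There is slack between the constructed orders and the claim: \<open>B\<close>
    exceeds \<open>3 * n - 4\<close> or \<open>2 * n - 3\<close> by 1, and \<open>2 * B\<close>
    exceeds \<open>6 * n - 8\<close> or \<open>4 * n - 6\<close> by 2.\<close>
  have gt: "?G \<ge> b * 5 ^ j + 1" if "avoidable ?r k (N * 5 ^ j)" "b \<le> N" for b N j
  proof -
    have "b * 5 ^ j \<le> N * 5 ^ j"
      using that by simp
    also have "\<dots> < ?G"
      using gallai_ramsey_wheel_gt[OF that(1)] assms by simp
    finally show ?thesis
      by simp
  qed
  show ?thesis
  proof (cases "even k")
    case True
    then have "2 + 2 * ((k - 2) div 2) = k"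
      using assms by simp
    then show ?thesis
      using True gt[of B "(k - 2) div 2"] even_bound[of "(k - 2) div 2"] by (auto simp: B_def)
  next
    case False
    then have "Suc 2 + 2 * ((k - 3) div 2) = k"
      using assms by presburger
    then show ?thesis
      using False gt[of "2 * B" "(k - 3) div 2"] odd_bound[of "(k - 3) div 2"]
      by (auto simp: B_def)
  qed
qed

end
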